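(* Let $f_4=(x^2,\,y^2)$ and $f_{4'}=(x^2-y^2,\,xy)$. The restriction $O_{\mathbb{C}}(f_4)\cap\Omega_{\mathbb{R}}(2,2)$ of the complex orbit of $f_4$ splits into two real orbits, given by the sign of $\overline{\Phi}_1$: $$O_{\mathbb{R}}(f_4)=\{f\in O_{\mathbb{C}}(f_4)\cap\Omega_{\mathbb{R}}(2,2):\overline{\Phi}_1(f)<0\},\qquad O_{\mathbb{R}}(f_{4'})=\{f\in O_{\mathbb{C}}(f_4)\cap\Omega_{\mathbb{R}}(2,2):\overline{\Phi}_1(f)>0\}.$$ The first case is represented by $f_4$, with $C(f_4)=\{4xy=0\}$ two intersecting lines and $\Delta(f_4)=\{xy=0\}$ also two intersecting lines. The second case is represented by $f_{4'}$, with $C(f_{4'})=\{2x^2+2y^2=0\}$ a point.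
   Context: For $K=\mathbb{R}$ or $\mathbb{C}$, $\Omega_K(2,2)$ is the space of polynomial mappings $f:K^2\to K^2$ with both components of degree $\le 2$; $\Omega_{\mathbb{R}}(2,2)\subset\Omega_{\mathbb{C}}(2,2)$ by viewing real polynomials as complex ones. $GA_K(2,2)$ is the group of affine automorphisms of $K^2$ and $O_K(f)=\{L\circ f\circ R:L,R\in GA_K(2,2)\}$. Write the Jacobian determinant as $J(f)=Ax^2+Bxy+Cy^2+Dx+Ey+F$; then $\overline{\Phi}_1(f)=\det\begin{pmatrix} 2A & B \\ B & 2C \end{pmatrix}=4AC-B^2$. For real $f$, $C(f)=\{J(f)=0\}\subset\mathbb{R}^2$ is the critical set and $\Delta(f)=f(C(f))$.
   Formalization: As f_4=(x²,y²) has nonnegative components, Δ(f_4)=f_4(C(f_4)) in ℝ² omits (−1,0) and is not {xy=0}; the formal text proves it is the two half-axes {xy=0, x,y≥0}, with Zariski closure {xy=0} (two intersecting lines), and that the complex image is {xy=0}. *)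

theory Defs
  imports "HOL-Analysis.Analysis" "HOL-Computational_Algebra.Polynomial"
begin

text \<open>
  Polynomials in two variables over \<open>K\<close> are elements of \<open>K[x][y]\<close>: the coefficient of
  \<open>x ^ i * y ^ j\<close> in \<open>p\<close> is \<open>coeff (coeff p j) i\<close>.
\<close>

type_synonym 'a polymap = "'a poly poly \<times> 'a poly poly"

definition varX :: "'a::comm_ring_1 poly poly" where
  "varX = [:[:0, 1:]:]"

definition varY :: "'a::comm_ring_1 poly poly" where
  "varY = [:0, 1:]"

definition coeff2 :: "'a::zero poly poly \<Rightarrow> nat \<Rightarrow> nat \<Rightarrow> 'a" where
  "coeff2 p i j = coeff (coeff p j) i"

definition eval2 :: "'a::comm_ring_1 poly poly \<Rightarrow> 'a \<times> 'a \<Rightarrow> 'a" where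
  "eval2 p = (\<lambda>(x, y). poly (poly p [:y:]) x)"

definition total_degree_le :: "nat \<Rightarrow> 'a::zero poly poly \<Rightarrow> bool" where
  "total_degree_le d p \<longleftrightarrow> (\<forall>i j. coeff2 p i j \<noteq> 0 \<longrightarrow> i + j \<le> d)"

definition map_of_polymap :: "'a::comm_ring_1 polymap \<Rightarrow> 'a \<times> 'a \<Rightarrow> 'a \<times> 'a" where
  "map_of_polymap f = (\<lambda>v. (eval2 (fst f) v, eval2 (snd f) v))"

definition Omega22 :: "'a::zero polymap set" where
  "Omega22 = {f. total_degree_le 2 (fst f) \<and> total_degree_le 2 (snd f)}"

definition complexify :: "real polymap \<Rightarrow> complex polymap" where
  "complexify f = (map_poly (map_poly complex_of_real) (fst f),
                   map_poly (map_poly complex_of_real) (snd f))"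

definition GA22 :: "('a::comm_ring_1 \<times> 'a \<Rightarrow> 'a \<times> 'a) set" where
  "GA22 = {L. bij L \<and>
     (\<exists>a b c d e f. L = (\<lambda>(x, y). (a * x + b * y + e, c * x + d * y + f)))}"

text \<open>
  Since \<open>K\<close> is infinite, a polynomial mapping is determined by the function it induces, so
  membership in the orbit may be expressed by an equation between functions.
\<close>

definition orbit22 :: "'a::field_char_0 polymap \<Rightarrow> 'a polymap set" where
  "orbit22 f = {g. \<exists>L\<in>GA22. \<exists>R\<in>GA22.
     map_of_polymap g = L \<circ> map_of_polymap f \<circ> R}"

definition pd_x :: "'a::field_char_0 poly poly \<Rightarrow> 'a poly poly" where
  "pd_x p = map_poly pderiv p"

definition pd_y :: "'a::field_char_0 poly poly \<Rightarrow> 'a poly poly" where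
  "pd_y p = pderiv p"

definition jacobian :: "'a::field_char_0 polymap \<Rightarrow> 'a poly poly" where
  "jacobian f = pd_x (fst f) * pd_y (snd f) - pd_y (fst f) * pd_x (snd f)"

definition Phi1 :: "'a::field_char_0 polymap \<Rightarrow> 'a" where
  "Phi1 f = (let A = coeff2 (jacobian f) 2 0;
                 B = coeff2 (jacobian f) 1 1;
                 C = coeff2 (jacobian f) 0 2
             in 4 * A * C - B\<^sup>2)"

definition critical_set :: "'a::field_char_0 polymap \<Rightarrow> ('a \<times> 'a) set" where
  "critical_set f = {v. eval2 (jacobian f) v = 0}"

definition discriminant_set :: "'a::field_char_0 polymap \<Rightarrow> ('a \<times> 'a) set" where
  "discriminant_set f = map_of_polymap f ` critical_set f"

text \<open>
  Over the reals, \<open>f(C(f))\<close> need not be an algebraic set: for \<open>(x\<^sup>2, y\<^sup>2)\<close> it consists of two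
  half-lines, and only its Zariski closure is the curve \<open>x * y = 0\<close>.
\<close>

definition zariski_closure :: "('a::field_char_0 \<times> 'a) set \<Rightarrow> ('a \<times> 'a) set" where
  "zariski_closure S = {v. \<forall>p. (\<forall>u\<in>S. eval2 p u = 0) \<longrightarrow> eval2 p v = 0}"

definition two_intersecting_lines :: "(real \<times> real) set \<Rightarrow> bool" where
  "two_intersecting_lines S \<longleftrightarrow> (\<exists>l m.
     affine l \<and> aff_dim l = 1 \<and> affine m \<and> aff_dim m = 1 \<and>
     l \<noteq> m \<and> l \<inter> m \<noteq> {} \<and> S = l \<union> m)"

definition f4 :: "'a::field_char_0 polymap" where
  "f4 = (varX\<^sup>2, varY\<^sup>2)"

definition f4' :: "'a::field_char_0 polymap" where
  "f4' = (varX\<^sup>2 - varY\<^sup>2, varX * varY)"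

text \<open>The set \<open>O\<^sub>\<complex>(f\<^sub>4) \<inter> \<Omega>\<^sub>\<real>(2,2)\<close>, as a set of real polynomial mappings.\<close>

definition real_restriction_of_orbit_f4 :: "real polymap set" where
  "real_restriction_of_orbit_f4 = {f \<in> Omega22. complexify f \<in> orbit22 f4}"

end

theory Submission
  imports Defs
begin

text \<open>
  Every member of the orbit of \<open>(x\<^sup>2, y\<^sup>2)\<close> or of \<open>(x\<^sup>2 - y\<^sup>2, xy)\<close> has a point at which the
  gradients of both components vanish, namely the preimage of the origin under the inner affine
  map. Translated to this centre, and up to additive constants, the mapping is a pair \<open>(p, q)\<close> of
  binary quadratic forms, so the question is which pencils \<open>\<langle>p, q\<rangle>\<close> are equivalent to
  \<open>\<langle>x\<^sup>2, y\<^sup>2\<rangle>\<close> or to \<open>\<langle>x\<^sup>2 - y\<^sup>2, xy\<rangle>\<close> under linear substitutions. Write \<open>u\<close>, \<open>v\<close>, \<open>w\<close> for the three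
  \<open>2 \<times> 2\<close> minors of the coefficient matrix of \<open>p\<close> and \<open>q\<close>. The Jacobian of \<open>(p, q)\<close> is
  \<open>2 (u x\<^sup>2 + 2 v x y + w y\<^sup>2)\<close>, its invariant \<open>\<Phi>\<close> is \<open>16 (u w - v\<^sup>2)\<close>, and for independent \<open>p\<close>, \<open>q\<close>
  the pencil is the plane of all forms \<open>A x\<^sup>2 + B x y + C y\<^sup>2\<close> with \<open>A w - B v + C u = 0\<close>. Hence the
  Jacobian determines the pencil: if it factors into two independent linear forms
  (\<open>-\<Phi>\<close> is a nonzero square), the pencil is spanned by the squares of these forms; if it is a
  definite real form (\<open>\<Phi> > 0\<close>), bringing it to a multiple of \<open>X\<^sup>2 + Y\<^sup>2\<close> turns the pencil into
  \<open>\<langle>X\<^sup>2 - Y\<^sup>2, XY\<rangle>\<close>.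

  This characterises the orbits (\<open>orbit22_f4_iff\<close>, \<open>orbit22_f4'_iff\<close>): membership means having a
  centre together with \<open>-\<Phi>\<close> being a nonzero square, respectively \<open>\<Phi> > 0\<close>. Over the complex
  numbers the first condition reads \<open>\<Phi> \<noteq> 0\<close>, over the reals \<open>\<Phi> < 0\<close>. A real mapping with a complex
  centre has a real one, because the centre solves a linear system with real coefficients and the
  real part of a solution is again a solution (\<open>has_centre_complexify\<close>). So the real part of the
  complex orbit consists of the real mappings with a centre and \<open>\<Phi> \<noteq> 0\<close>, and the sign of \<open>\<Phi>\<close>
  separates the two real orbits.
\<close>

section \<open>Polynomials of degree at most two in two variables\<close>

definition quad :: "'a \<Rightarrow> 'a \<Rightarrow> 'a \<Rightarrow> 'a \<Rightarrow> 'a \<Rightarrow> 'a::comm_ring_1 \<Rightarrow> 'a poly poly" where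
  "quad a b c d e h = [:[:h, d, a:], [:e, b:], [:c:]:]"

lemma eval2_quad:
  "eval2 (quad a b c d e h) (x, y) = a * x\<^sup>2 + b * x * y + c * y\<^sup>2 + d * x + e * y + h"
  by (simp add: eval2_def quad_def algebra_simps power2_eq_square)

lemma total_degree_le_quad: "total_degree_le 2 (quad a b c d e h)"
  unfolding total_degree_le_def coeff2_def quad_def
  by (auto simp: coeff_pCons split: nat.splits)

lemma quad_if_total_degree_le:
  assumes "total_degree_le 2 p"
  shows "p = quad (coeff2 p 2 0) (coeff2 p 1 1) (coeff2 p 0 2)
                  (coeff2 p 1 0) (coeff2 p 0 1) (coeff2 p 0 0)"
proof -
  have z: "coeff (coeff p j) i = 0" if "i + j > 2" for i j
    using assms that unfolding total_degree_le_def coeff2_def by (meson not_le)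
  have "coeff (coeff p j) i = coeff (coeff (quad (coeff2 p 2 0) (coeff2 p 1 1) (coeff2 p 0 2)
                  (coeff2 p 1 0) (coeff2 p 0 1) (coeff2 p 0 0)) j) i" for i j
    unfolding quad_def coeff2_def
    by (auto simp: coeff_pCons z numeral_2_eq_2 split: nat.splits)
  thus ?thesis by (simp add: poly_eq_iff)
qed

text \<open>
  For fixed \<open>y\<close>, the one-variable polynomials in \<open>x\<close> obtained from \<open>p\<close> and \<open>q\<close> have equal values and
  so are equal; thus \<open>p - q\<close>, as a polynomial over the domain \<open>K[x]\<close>, has every constant as a root.
\<close>

lemma eval2_inject:
  fixes p q :: "'a::field_char_0 poly poly"
  assumes "\<And>x y. eval2 p (x, y) = eval2 q (x, y)"
  shows "p = q"
proof -
  have "poly p [:y:] = poly q [:y:]" for y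
    using assms[of _ y] by (simp add: eval2_def flip: poly_eq_poly_eq_iff) (auto simp: fun_eq_iff)
  hence "range (\<lambda>y. [:y:]) \<subseteq> {z. poly (p - q) z = 0}" by auto
  moreover have "infinite (range (\<lambda>y::'a. [:y:]))"
    by (simp add: finite_image_iff inj_on_def infinite_UNIV_char_0)
  ultimately have "infinite {z. poly (p - q) z = 0}" using finite_subset by blast
  thus ?thesis using poly_roots_finite[of "p - q"] by auto
qed

lemma map_quad: "map_of_polymap (quad p0 p1 p2 p3 p4 p5, quad q0 q1 q2 q3 q4 q5) (x, y) =
   (p0 * x\<^sup>2 + p1 * x * y + p2 * y\<^sup>2 + p3 * x + p4 * y + p5,
    q0 * x\<^sup>2 + q1 * x * y + q2 * y\<^sup>2 + q3 * x + q4 * y + q5)"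
  by (simp add: map_of_polymap_def eval2_quad)

lemma map_of_polymap_inject:
  fixes f g :: "'a::field_char_0 polymap"
  assumes "\<And>x y. map_of_polymap f (x, y) = map_of_polymap g (x, y)"
  shows "f = g"
  using assms by (auto simp: map_of_polymap_def prod_eq_iff intro!: eval2_inject)

lemma quad_inject:
  "quad a b c d e h = quad a' b' c' d' e' h' \<longleftrightarrow>
   a = a' \<and> b = b' \<and> c = c' \<and> d = d' \<and> e = e' \<and> h = h'"
  by (auto simp: quad_def)

lemma Phi1_quad:
  fixes p0 :: "'a::field_char_0"
  shows "Phi1 (quad p0 p1 p2 p3 p4 p5, quad q0 q1 q2 q3 q4 q5) =
    16 * ((p0 * q1 - p1 * q0) * (p1 * q2 - p2 * q1) - (p0 * q2 - p2 * q0)\<^sup>2)"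
  by (simp add: Phi1_def jacobian_def pd_x_def pd_y_def quad_def map_poly_pCons pderiv_pCons
      coeff2_def numeral_2_eq_2 Let_def algebra_simps)

lemma complexify_quad:
  "complexify (quad p0 p1 p2 p3 p4 p5, quad q0 q1 q2 q3 q4 q5) =
    (quad (of_real p0) (of_real p1) (of_real p2) (of_real p3) (of_real p4) (of_real p5),
     quad (of_real q0) (of_real q1) (of_real q2) (of_real q3) (of_real q4) (of_real q5))"
  by (simp add: complexify_def quad_def map_poly_pCons)

lemma Omega22E:
  assumes "f \<in> Omega22"
  obtains p0 p1 p2 p3 p4 p5 q0 q1 q2 q3 q4 q5
  where "f = (quad p0 p1 p2 p3 p4 p5, quad q0 q1 q2 q3 q4 q5)"
  using assms quad_if_total_degree_le unfolding Omega22_def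
  by (metis (mono_tags, lifting) mem_Collect_eq prod.collapse)

section \<open>Affine automorphisms and orbits\<close>

text \<open>
  A zero determinant puts \<open>(d, -c)\<close> and \<open>(-b, a)\<close> into the kernel of the linear part; injectivity
  then makes the linear part zero, which again contradicts injectivity.
\<close>

lemma GA22_iff:
  fixes L :: "'a::field_char_0 \<times> 'a \<Rightarrow> 'a \<times> 'a"
  shows "L \<in> GA22 \<longleftrightarrow> (\<exists>a b c d e f. a * d - b * c \<noteq> 0 \<and>
    L = (\<lambda>(x, y). (a * x + b * y + e, c * x + d * y + f)))" (is "_ \<longleftrightarrow> ?R")
proof
  assume "L \<in> GA22"
  then obtain a b c d e f where L: "L = (\<lambda>(x, y). (a * x + b * y + e, c * x + d * y + f))"
    and "bij L" by (auto simp: GA22_def)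
  hence inj: "u = v" if "L u = L v" for u v using that by (meson bij_is_inj injD)
  have "a * d - b * c \<noteq> 0"
  proof
    assume z: "a * d - b * c = 0"
    have "(d, - c) = (0, 0)" "(- b, a) = (0, 0)"
      by (rule inj; use z in \<open>simp add: L algebra_simps\<close>)+
    hence "L (1, 0) = L (0, 0)" by (simp add: L)
    thus False using inj[of "(1, 0)" "(0, 0)"] by simp
  qed
  thus ?R using L by (intro exI conjI)
next
  assume ?R
  then obtain a b c d e f where E: "a * d - b * c \<noteq> 0"
    and L: "L = (\<lambda>(x, y). (a * x + b * y + e, c * x + d * y + f))" by blast
  have "bij L"
  proof (rule o_bij)
    let ?M = "\<lambda>(x, y). ((d * (x - e) - b * (y - f)) / (a * d - b * c),
                         (a * (y - f) - c * (x - e)) / (a * d - b * c))"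
    show "?M \<circ> L = id"
      using E by (auto simp: L fun_eq_iff divide_simps) (auto simp: algebra_simps)
    show "L \<circ> ?M = id"
      using E by (auto simp: L fun_eq_iff divide_simps) (auto simp: algebra_simps)
  qed
  thus "L \<in> GA22" unfolding GA22_def using L by (intro CollectI conjI exI)
qed

text \<open>
  The inner affine map is written relative to the preimage \<open>(s, t)\<close> of the origin, which becomes the
  centre when \<open>g\<close> is homogeneous.
\<close>

lemma orbit22_iff:
  fixes f g :: "'a::field_char_0 polymap"
  shows "f \<in> orbit22 g \<longleftrightarrow> (\<exists>\<alpha> \<beta> \<alpha>' \<beta>' h h' a b c d s t.
    \<alpha> * \<beta>' - \<beta> * \<alpha>' \<noteq> 0 \<and> a * d - b * c \<noteq> 0 \<and>
    (\<forall>x y. map_of_polymap f (x, y) =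
      (let (X, Y) = map_of_polymap g (a * (x - s) + b * (y - t), c * (x - s) + d * (y - t))
       in (\<alpha> * X + \<beta> * Y + h, \<alpha>' * X + \<beta>' * Y + h'))))" (is "_ \<longleftrightarrow> ?R")
proof
  assume "f \<in> orbit22 g"
  then obtain L R where "L \<in> GA22" "R \<in> GA22" and f: "map_of_polymap f = L \<circ> map_of_polymap g \<circ> R"
    by (auto simp: orbit22_def)
  then obtain \<alpha> \<beta> \<alpha>' \<beta>' h h' a b c d e e' where D: "\<alpha> * \<beta>' - \<beta> * \<alpha>' \<noteq> 0"
    and E: "a * d - b * c \<noteq> 0"
    and L: "L = (\<lambda>(x, y). (\<alpha> * x + \<beta> * y + h, \<alpha>' * x + \<beta>' * y + h'))"
    and R: "R = (\<lambda>(x, y). (a * x + b * y + e, c * x + d * y + e'))"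
    unfolding GA22_iff by blast
  define s where "s = (b * e' - d * e) / (a * d - b * c)"
  define t where "t = (c * e - a * e') / (a * d - b * c)"
  have "a * s + b * t = (a * (b * e' - d * e) + b * (c * e - a * e')) / (a * d - b * c)"
    by (simp add: s_def t_def add_divide_distrib)
  also have "\<dots> = - e * (a * d - b * c) / (a * d - b * c)" by (simp add: algebra_simps)
  finally have 1: "e = - (a * s + b * t)" using E by simp
  have "c * s + d * t = (c * (b * e' - d * e) + d * (c * e - a * e')) / (a * d - b * c)"
    by (simp add: s_def t_def add_divide_distrib)
  also have "\<dots> = - e' * (a * d - b * c) / (a * d - b * c)" by (simp add: algebra_simps)
  finally have 2: "e' = - (c * s + d * t)" using E by simp
  have R': "R (x, y) = (a * (x - s) + b * (y - t), c * (x - s) + d * (y - t))" for x y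
    by (simp add: R 1 2 algebra_simps)
  have "map_of_polymap f (x, y) =
      (let (X, Y) = map_of_polymap g (a * (x - s) + b * (y - t), c * (x - s) + d * (y - t))
       in (\<alpha> * X + \<beta> * Y + h, \<alpha>' * X + \<beta>' * Y + h'))" for x y
    unfolding f o_apply R' L Let_def ..
  with D E show ?R by (intro exI conjI allI)
next
  assume ?R
  then obtain \<alpha> \<beta> \<alpha>' \<beta>' h h' a b c d s t where
    D: "\<alpha> * \<beta>' - \<beta> * \<alpha>' \<noteq> 0" and E: "a * d - b * c \<noteq> 0" and
    f: "\<And>x y. map_of_polymap f (x, y) =
      (let (X, Y) = map_of_polymap g (a * (x - s) + b * (y - t), c * (x - s) + d * (y - t))
       in (\<alpha> * X + \<beta> * Y + h, \<alpha>' * X + \<beta>' * Y + h'))" by blast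
  let ?L = "\<lambda>(x, y). (\<alpha> * x + \<beta> * y + h, \<alpha>' * x + \<beta>' * y + h')"
  let ?R = "\<lambda>(x, y). (a * x + b * y + - (a * s + b * t), c * x + d * y + - (c * s + d * t))"
  have "?L \<in> GA22" "?R \<in> GA22"
    unfolding GA22_iff by (intro exI conjI; rule D E refl)+
  moreover have "?R (x, y) = (a * (x - s) + b * (y - t), c * (x - s) + d * (y - t))" for x y
    by (simp add: algebra_simps)
  hence "map_of_polymap f = ?L \<circ> map_of_polymap g \<circ> ?R"
    by (auto simp: fun_eq_iff f Let_def)
  ultimately show "f \<in> orbit22 g" unfolding orbit22_def by blast
qed

lemma map_f4: "map_of_polymap f4 (x, y) = (x\<^sup>2, y\<^sup>2)"
  by (simp add: map_of_polymap_def f4_def eval2_def varX_def varY_def)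

lemma map_f4': "map_of_polymap f4' (x, y) = (x\<^sup>2 - y\<^sup>2, x * y)"
  by (simp add: map_of_polymap_def f4'_def eval2_def varX_def varY_def mult.commute)

section \<open>Mappings with a centre\<close>

definition qform :: "'a \<Rightarrow> 'a \<Rightarrow> 'a \<Rightarrow> 'a \<Rightarrow> 'a \<Rightarrow> 'a::comm_ring_1" where
  "qform a b c x y = a * x\<^sup>2 + b * x * y + c * y\<^sup>2"

definition centred :: "'a \<Rightarrow> 'a \<Rightarrow> 'a \<Rightarrow> 'a \<Rightarrow> 'a \<Rightarrow> 'a \<Rightarrow> 'a::field_char_0 polymap \<Rightarrow> bool" where
  "centred p0 p1 p2 q0 q1 q2 f \<longleftrightarrow> (\<exists>s t h h'. \<forall>x y. map_of_polymap f (x, y) =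
     (qform p0 p1 p2 (x - s) (y - t) + h, qform q0 q1 q2 (x - s) (y - t) + h'))"

definition has_centre :: "'a::field_char_0 polymap \<Rightarrow> bool" where
  "has_centre f \<longleftrightarrow> (\<exists>p0 p1 p2 q0 q1 q2. centred p0 p1 p2 q0 q1 q2 f)"

text \<open>
  In terms of coefficients, a centre \<open>(s, t)\<close> is a solution of the linear equations saying that both
  gradients vanish there. This linearity is what allows the descent from \<open>\<complex>\<close> to \<open>\<real>\<close>.
\<close>

lemma centred_iff:
  "centred p0 p1 p2 q0 q1 q2 f \<longleftrightarrow> (\<exists>s t h h'.
    f = (quad p0 p1 p2 (- (2 * p0 * s + p1 * t)) (- (p1 * s + 2 * p2 * t)) h,
         quad q0 q1 q2 (- (2 * q0 * s + q1 * t)) (- (q1 * s + 2 * q2 * t)) h'))" (is "_ \<longleftrightarrow> ?R")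
proof
  assume "centred p0 p1 p2 q0 q1 q2 f"
  then obtain s t h h' where f: "\<And>x y. map_of_polymap f (x, y) =
     (qform p0 p1 p2 (x - s) (y - t) + h, qform q0 q1 q2 (x - s) (y - t) + h')"
    unfolding centred_def by blast
  have "f = (quad p0 p1 p2 (- (2 * p0 * s + p1 * t)) (- (p1 * s + 2 * p2 * t)) (h + qform p0 p1 p2 s t),
         quad q0 q1 q2 (- (2 * q0 * s + q1 * t)) (- (q1 * s + 2 * q2 * t)) (h' + qform q0 q1 q2 s t))"
    by (rule map_of_polymap_inject)
       (simp add: f map_quad qform_def power2_eq_square algebra_simps)
  thus ?R by blast
next
  assume ?R
  then obtain s t h h' where f:
    "f = (quad p0 p1 p2 (- (2 * p0 * s + p1 * t)) (- (p1 * s + 2 * p2 * t)) h,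
         quad q0 q1 q2 (- (2 * q0 * s + q1 * t)) (- (q1 * s + 2 * q2 * t)) h')" by blast
  have "map_of_polymap f (x, y) = (qform p0 p1 p2 (x - s) (y - t) + (h - qform p0 p1 p2 s t),
     qform q0 q1 q2 (x - s) (y - t) + (h' - qform q0 q1 q2 s t))" for x y
    by (simp add: f map_quad qform_def power2_eq_square algebra_simps)
  thus "centred p0 p1 p2 q0 q1 q2 f" unfolding centred_def by blast
qed

lemma Phi1_centred:
  assumes "centred p0 p1 p2 q0 q1 q2 f"
  shows "Phi1 f = 16 * ((p0 * q1 - p1 * q0) * (p1 * q2 - p2 * q1) - (p0 * q2 - p2 * q0)\<^sup>2)"
  using assms by (auto simp: centred_iff Phi1_quad)

lemma has_centre_Omega22:
  assumes "has_centre f"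
  shows "f \<in> Omega22"
  using assms by (auto simp: has_centre_def centred_iff Omega22_def total_degree_le_quad)

section \<open>The orbits of the two normal forms\<close>

text \<open>
  For \<open>L \<circ> f4 \<circ> R\<close> one gets \<open>\<Phi> = -(4 det(L) det(R)\<^sup>2)\<^sup>2\<close>. Conversely, a root \<open>k\<close> of
  \<open>k\<^sup>2 = v\<^sup>2 - u w\<close> gives the linear forms whose squares lie in the pencil.
\<close>

lemma orbit22_f4_iff:
  fixes f :: "'a::field_char_0 polymap"
  shows "f \<in> orbit22 f4 \<longleftrightarrow>
    has_centre f \<and> (\<exists>r. r \<noteq> 0 \<and> Phi1 f = - r\<^sup>2)"
   (is "_ \<longleftrightarrow> ?R")
proof
  assume "f \<in> orbit22 f4"
  then obtain \<alpha> \<beta> \<alpha>' \<beta>' h h' a b c d s t where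
    D: "\<alpha> * \<beta>' - \<beta> * \<alpha>' \<noteq> 0" and E: "a * d - b * c \<noteq> 0" and
    f: "\<And>x y. map_of_polymap f (x, y) =
      (\<alpha> * (a * (x - s) + b * (y - t))\<^sup>2 + \<beta> * (c * (x - s) + d * (y - t))\<^sup>2 + h,
       \<alpha>' * (a * (x - s) + b * (y - t))\<^sup>2 + \<beta>' * (c * (x - s) + d * (y - t))\<^sup>2 + h')"
    unfolding orbit22_iff map_f4 Let_def prod.case by blast
  have C: "centred
     (\<alpha> * a\<^sup>2 + \<beta> * c\<^sup>2) (2 * (\<alpha> * a * b + \<beta> * c * d)) (\<alpha> * b\<^sup>2 + \<beta> * d\<^sup>2)
     (\<alpha>' * a\<^sup>2 + \<beta>' * c\<^sup>2) (2 * (\<alpha>' * a * b + \<beta>' * c * d)) (\<alpha>' * b\<^sup>2 + \<beta>' * d\<^sup>2) f"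
    unfolding centred_def f qform_def
    by (intro exI[of _ s] exI[of _ t] exI[of _ h] exI[of _ h'] allI)
       (simp; algebra)
  moreover have "Phi1 f = - (4 * (\<alpha> * \<beta>' - \<beta> * \<alpha>') * (a * d - b * c)\<^sup>2)\<^sup>2"
    unfolding Phi1_centred[OF C] by algebra
  moreover have "4 * (\<alpha> * \<beta>' - \<beta> * \<alpha>') * (a * d - b * c)\<^sup>2 \<noteq> 0" using D E by simp
  ultimately show ?R unfolding has_centre_def by blast
next
  assume ?R
  then obtain p0 p1 p2 q0 q1 q2 r where C: "centred p0 p1 p2 q0 q1 q2 f"
    and r: "r \<noteq> 0" and \<Phi>: "Phi1 f = - r\<^sup>2"
    unfolding has_centre_def by blast
  define u v w where "u = p0 * q1 - p1 * q0" and "v = p0 * q2 - p2 * q0" and "w = p1 * q2 - p2 * q1"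
  note uvw = u_def v_def w_def
  have "16 * (v\<^sup>2 - u * w) = r\<^sup>2" using \<Phi> unfolding Phi1_centred[OF C] uvw by algebra
  hence r4: "(r / 4)\<^sup>2 = v\<^sup>2 - u * w"
    by (simp add: power_divide divide_eq_eq mult.commute)
  \<comment> \<open>The sign of the root is chosen so that the two linear forms below are independent.\<close>
  have "v + r / 4 \<noteq> 0 \<or> v + - r / 4 \<noteq> 0"
  proof (rule ccontr)
    assume "\<not> ?thesis"
    hence "v + r / 4 - (v + - r / 4) = 0" by simp
    thus False using r by (simp add: field_simps)
  qed
  then obtain k where k: "k \<noteq> 0" "k\<^sup>2 = v\<^sup>2 - u * w" "v + k \<noteq> 0"
    using r4 r by (metis divide_eq_0_iff neg_equal_0_iff_equal power2_minus minus_divide_left zero_neq_numeral)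
  \<comment> \<open>A square \<open>(a x + b y)\<^sup>2\<close> lies in the pencil iff \<open>w a\<^sup>2 - 2 v a b + u b\<^sup>2 = 0\<close>. The two
    solutions \<open>(m, w)\<close> and \<open>(u, m)\<close> have determinant \<open>E\<close>; writing them in this mixed way avoids
    dividing by \<open>u\<close> or \<open>w\<close>, either of which may vanish.\<close>
  define m where "m = v + k"
  define E where "E = m * m - w * u"
  have E2: "E = 2 * k * m" unfolding E_def m_def using k(2) by algebra
  hence E: "E \<noteq> 0" using k by (simp add: m_def)
  have mm: "m * m + u * w = 2 * v * m" unfolding m_def using k(2) by algebra
  have decomp: "qform A B C' x y = (A * m\<^sup>2 - B * m * u + C' * u\<^sup>2) / E\<^sup>2 * (m * x + w * y)\<^sup>2
       + (A * w\<^sup>2 - B * m * w + C' * m\<^sup>2) / E\<^sup>2 * (u * x + m * y)\<^sup>2"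
    if pencil: "A * w - B * v + C' * u = 0" for A B C' x y
  proof -
    have "E\<^sup>2 * qform A B C' x y = (A * m\<^sup>2 - B * m * u + C' * u\<^sup>2) * (m * x + w * y)\<^sup>2
       + (A * w\<^sup>2 - B * m * w + C' * m\<^sup>2) * (u * x + m * y)\<^sup>2"
      unfolding qform_def E_def using pencil mm by algebra
    hence "qform A B C' x y = ((A * m\<^sup>2 - B * m * u + C' * u\<^sup>2) * (m * x + w * y)\<^sup>2
       + (A * w\<^sup>2 - B * m * w + C' * m\<^sup>2) * (u * x + m * y)\<^sup>2) / E\<^sup>2"
      using E by (simp add: eq_divide_eq mult.commute)
    thus ?thesis by (simp only: add_divide_distrib[of "_ * _" "_ * _"] times_divide_eq_left)
  qed
  define \<alpha> \<beta> \<alpha>' \<beta>' where "\<alpha> = (p0 * m\<^sup>2 - p1 * m * u + p2 * u\<^sup>2) / E\<^sup>2"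
    and "\<beta> = (p0 * w\<^sup>2 - p1 * m * w + p2 * m\<^sup>2) / E\<^sup>2"
    and "\<alpha>' = (q0 * m\<^sup>2 - q1 * m * u + q2 * u\<^sup>2) / E\<^sup>2"
    and "\<beta>' = (q0 * w\<^sup>2 - q1 * m * w + q2 * m\<^sup>2) / E\<^sup>2"
  have P: "qform p0 p1 p2 x y = \<alpha> * (m * x + w * y)\<^sup>2 + \<beta> * (u * x + m * y)\<^sup>2" for x y
    unfolding \<alpha>_def \<beta>_def by (rule decomp) (unfold uvw, algebra)
  have Q: "qform q0 q1 q2 x y = \<alpha>' * (m * x + w * y)\<^sup>2 + \<beta>' * (u * x + m * y)\<^sup>2" for x y
    unfolding \<alpha>'_def \<beta>'_def by (rule decomp) (unfold uvw, algebra)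
  have "\<alpha> * \<beta>' - \<beta> * \<alpha>' \<noteq> 0"
  proof
    assume z: "\<alpha> * \<beta>' - \<beta> * \<alpha>' = 0"
    \<comment> \<open>The two forms would be linearly dependent, so the minors \<open>u\<close> and \<open>v\<close>, and with them \<open>k\<close>, vanish.\<close>
    have dep: "qform p0 p1 p2 x y * qform q0 q1 q2 x' y' = qform p0 p1 p2 x' y' * qform q0 q1 q2 x y" for x y x' y'
      unfolding P Q using z by algebra
    have "u = 0" using dep[of 1 0 1 1] dep[of 1 0 0 1] by (simp add: qform_def u_def algebra_simps)
    moreover have "v = 0" using dep[of 1 0 0 1] by (simp add: qform_def v_def algebra_simps)
    ultimately show False using k by simp
  qed
  moreover have "m * m - w * u \<noteq> 0" using E by (simp add: E_def)
  moreover obtain s t h h' where "\<And>x y. map_of_polymap f (x, y) =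
     (qform p0 p1 p2 (x - s) (y - t) + h, qform q0 q1 q2 (x - s) (y - t) + h')"
    using C unfolding centred_def by blast
  ultimately show "f \<in> orbit22 f4"
    unfolding orbit22_iff map_f4 Let_def prod.case P Q by blast
qed

text \<open>
  For \<open>L \<circ> f4' \<circ> R\<close> one gets \<open>\<Phi> = (4 det(L) det(R)\<^sup>2)\<^sup>2\<close>. Conversely, completing the square gives
  \<open>u (u x\<^sup>2 + 2 v x y + w y\<^sup>2) = (u x + v y)\<^sup>2 + (k y)\<^sup>2\<close> with \<open>k\<^sup>2 = u w - v\<^sup>2\<close>, and the two squared
  forms serve as new coordinates.
\<close>

lemma orbit22_f4'_iff:
  fixes f :: "real polymap"
  shows "f \<in> orbit22 f4' \<longleftrightarrow>
    has_centre f \<and> Phi1 f > 0"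
   (is "_ \<longleftrightarrow> ?R")
proof
  assume "f \<in> orbit22 f4'"
  then obtain \<alpha> \<beta> \<alpha>' \<beta>' h h' a b c d s t where
    D: "\<alpha> * \<beta>' - \<beta> * \<alpha>' \<noteq> 0" and E: "a * d - b * c \<noteq> 0" and
    f: "\<And>x y. map_of_polymap f (x, y) =
      (\<alpha> * ((a * (x - s) + b * (y - t))\<^sup>2 - (c * (x - s) + d * (y - t))\<^sup>2)
         + \<beta> * ((a * (x - s) + b * (y - t)) * (c * (x - s) + d * (y - t))) + h,
       \<alpha>' * ((a * (x - s) + b * (y - t))\<^sup>2 - (c * (x - s) + d * (y - t))\<^sup>2)
         + \<beta>' * ((a * (x - s) + b * (y - t)) * (c * (x - s) + d * (y - t))) + h')"
    unfolding orbit22_iff map_f4' Let_def prod.case by blast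
  have C: "centred
     (\<alpha> * (a\<^sup>2 - c\<^sup>2) + \<beta> * a * c) (2 * \<alpha> * (a * b - c * d) + \<beta> * (a * d + b * c))
     (\<alpha> * (b\<^sup>2 - d\<^sup>2) + \<beta> * b * d)
     (\<alpha>' * (a\<^sup>2 - c\<^sup>2) + \<beta>' * a * c) (2 * \<alpha>' * (a * b - c * d) + \<beta>' * (a * d + b * c))
     (\<alpha>' * (b\<^sup>2 - d\<^sup>2) + \<beta>' * b * d) f"
    unfolding centred_def f qform_def
    by (intro exI[of _ s] exI[of _ t] exI[of _ h] exI[of _ h'] allI)
       (simp; algebra)
  have "Phi1 f = (4 * (\<alpha> * \<beta>' - \<beta> * \<alpha>') * (a * d - b * c)\<^sup>2)\<^sup>2"
    unfolding Phi1_centred[OF C] by algebra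
  moreover have "4 * (\<alpha> * \<beta>' - \<beta> * \<alpha>') * (a * d - b * c)\<^sup>2 \<noteq> 0" using D E by simp
  ultimately have "Phi1 f > 0" by simp
  thus ?R using C unfolding has_centre_def by blast
next
  assume ?R
  then obtain p0 p1 p2 q0 q1 q2 where C: "centred p0 p1 p2 q0 q1 q2 f"
    and \<Phi>: "Phi1 f > 0"
    unfolding has_centre_def by blast
  define u v w where "u = p0 * q1 - p1 * q0" and "v = p0 * q2 - p2 * q0" and "w = p1 * q2 - p2 * q1"
  note uvw = u_def v_def w_def
  have pos: "u * w - v\<^sup>2 > 0" using \<Phi> unfolding Phi1_centred[OF C] uvw by simp
  define k where "k = sqrt (u * w - v\<^sup>2)"
  have k: "k \<noteq> 0" "k\<^sup>2 = u * w - v\<^sup>2" using pos by (simp_all add: k_def)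
  have u: "u \<noteq> 0" using pos by auto
  have decomp: "qform A B C' x y = A / u\<^sup>2 * ((u * x + v * y)\<^sup>2 - (0 * x + k * y)\<^sup>2)
       + (B * u - 2 * A * v) / (k * u\<^sup>2) * ((u * x + v * y) * (0 * x + k * y))"
    if pencil: "A * w - B * v + C' * u = 0" for A B C' x y
  proof -
    have "u\<^sup>2 * qform A B C' x y = A * ((u * x + v * y)\<^sup>2 - (k * y)\<^sup>2)
       + (B * u - 2 * A * v) * ((u * x + v * y) * y)"
      unfolding qform_def using pencil k(2) by algebra
    hence "qform A B C' x y = (A * ((u * x + v * y)\<^sup>2 - (k * y)\<^sup>2)
       + (B * u - 2 * A * v) * ((u * x + v * y) * y)) / u\<^sup>2"
      using u by (simp add: eq_divide_eq mult.commute)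
    thus ?thesis using k(1) by (simp add: add_divide_distrib)
  qed
  define \<alpha> \<beta> \<alpha>' \<beta>' where "\<alpha> = p0 / u\<^sup>2" and "\<beta> = (p1 * u - 2 * p0 * v) / (k * u\<^sup>2)"
    and "\<alpha>' = q0 / u\<^sup>2" and "\<beta>' = (q1 * u - 2 * q0 * v) / (k * u\<^sup>2)"
  have P: "qform p0 p1 p2 x y = \<alpha> * ((u * x + v * y)\<^sup>2 - (0 * x + k * y)\<^sup>2)
       + \<beta> * ((u * x + v * y) * (0 * x + k * y))" for x y
    unfolding \<alpha>_def \<beta>_def by (rule decomp) (unfold uvw, algebra)
  have Q: "qform q0 q1 q2 x y = \<alpha>' * ((u * x + v * y)\<^sup>2 - (0 * x + k * y)\<^sup>2)
       + \<beta>' * ((u * x + v * y) * (0 * x + k * y))" for x y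
    unfolding \<alpha>'_def \<beta>'_def by (rule decomp) (unfold uvw, algebra)
  have "\<alpha> * \<beta>' - \<beta> * \<alpha>' = u * u / (k * u\<^sup>2 * u\<^sup>2)"
    unfolding \<alpha>_def \<beta>_def \<alpha>'_def \<beta>'_def using u k(1)
    by (simp add: field_simps) (simp add: u_def algebra_simps)
  hence "\<alpha> * \<beta>' - \<beta> * \<alpha>' \<noteq> 0" using u k(1) by simp
  moreover have "u * k - v * 0 \<noteq> 0" using u k by simp
  moreover obtain s t h h' where "\<And>x y. map_of_polymap f (x, y) =
     (qform p0 p1 p2 (x - s) (y - t) + h, qform q0 q1 q2 (x - s) (y - t) + h')"
    using C unfolding centred_def by blast
  ultimately show "f \<in> orbit22 f4'"
    unfolding orbit22_iff map_f4' Let_def prod.case P Q by blast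
qed

section \<open>Real mappings in the complex orbit\<close>

lemma Phi1_complexify:
  assumes "f \<in> Omega22"
  shows "Phi1 (complexify f) = of_real (Phi1 f)"
  using assms by (elim Omega22E) (simp add: complexify_quad Phi1_quad)

lemma has_centre_complexify:
  fixes f :: "real polymap"
  assumes "f \<in> Omega22"
  shows "has_centre (complexify f) \<longleftrightarrow>
    has_centre f" (is "?C \<longleftrightarrow> ?R")
proof
  assume ?C
  obtain p0 p1 p2 p3 p4 p5 q0 q1 q2 q3 q4 q5
    where f: "f = (quad p0 p1 p2 p3 p4 p5, quad q0 q1 q2 q3 q4 q5)"
    using assms by (rule Omega22E)
  from \<open>?C\<close> obtain s t :: complex where
    "of_real p3 = - (2 * of_real p0 * s + of_real p1 * t)"
    "of_real p4 = - (of_real p1 * s + 2 * of_real p2 * t)"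
    "of_real q3 = - (2 * of_real q0 * s + of_real q1 * t)"
    "of_real q4 = - (of_real q1 * s + 2 * of_real q2 * t)"
    by (auto simp: has_centre_def f complexify_quad centred_iff quad_inject)
  from this[THEN arg_cong[where f = Re]] have "centred p0 p1 p2 q0 q1 q2 f"
    unfolding centred_iff f quad_inject prod.inject
    by (intro exI[of _ "Re s"] exI[of _ "Re t"] exI[of _ p5] exI[of _ q5]) simp
  thus ?R unfolding has_centre_def by blast
next
  assume ?R
  then obtain p0 p1 p2 q0 q1 q2 s t h h' where
    "f = (quad p0 p1 p2 (- (2 * p0 * s + p1 * t)) (- (p1 * s + 2 * p2 * t)) h,
         quad q0 q1 q2 (- (2 * q0 * s + q1 * t)) (- (q1 * s + 2 * q2 * t)) h')"
    unfolding has_centre_def centred_iff by blast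
  hence "centred (of_real p0) (of_real p1) (of_real p2) (of_real q0) (of_real q1) (of_real q2)
    (complexify f)"
    unfolding centred_iff
    by (intro exI[of _ "of_real s"] exI[of _ "of_real t"] exI[of _ "of_real h"]
        exI[of _ "of_real h'"]) (simp add: complexify_quad)
  thus ?C unfolding has_centre_def by blast
qed

lemma real_restriction_iff:
  "f \<in> real_restriction_of_orbit_f4 \<longleftrightarrow>
    has_centre f \<and> Phi1 f \<noteq> 0"
proof -
  have sq: "(\<exists>r. r \<noteq> 0 \<and> z = - r\<^sup>2) \<longleftrightarrow> z \<noteq> 0" for z :: complex
    by (metis add.inverse_inverse neg_equal_0_iff_equal power2_csqrt zero_eq_power2)
  show ?thesis
    unfolding real_restriction_of_orbit_f4_def mem_Collect_eq orbit22_f4_iff sq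
    using has_centre_complexify Phi1_complexify has_centre_Omega22 by (metis of_real_eq_0_iff)
qed

lemma orbit22_f4_real_iff:
  fixes f :: "real polymap"
  shows "f \<in> orbit22 f4 \<longleftrightarrow>
    has_centre f \<and> Phi1 f < 0"
proof -
  have "(\<exists>r. r \<noteq> 0 \<and> z = - r\<^sup>2) \<longleftrightarrow> z < 0" for z :: real
  proof
    assume "z < 0"
    thus "\<exists>r. r \<noteq> 0 \<and> z = - r\<^sup>2" by (intro exI[of _ "sqrt (- z)"]) simp
  qed auto
  thus ?thesis unfolding orbit22_f4_iff by simp
qed

section \<open>Critical sets and discriminants\<close>

lemma orbit22_refl:
  fixes f :: "'a::field_char_0 polymap"
  shows "f \<in> orbit22 f"
proof -
  have "id = (\<lambda>(x :: 'a, y :: 'a). (1 * x + 0 * y + 0, 0 * x + 1 * y + 0))" by auto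
  moreover have "1 * 1 - 0 * 0 \<noteq> (0 :: 'a)" by simp
  ultimately have "(id :: 'a \<times> 'a \<Rightarrow> 'a \<times> 'a) \<in> GA22"
    unfolding GA22_iff by (intro exI conjI)
  thus ?thesis unfolding orbit22_def by (auto intro!: bexI[of _ id])
qed

lemma eval2_jacobian_f4: "eval2 (jacobian f4) (x, y) = 4 * x * y"
  by (simp add: jacobian_def f4_def pd_x_def pd_y_def varX_def varY_def power2_eq_square
      map_poly_pCons pderiv_pCons pderiv_minus eval2_def)

lemma eval2_jacobian_f4': "eval2 (jacobian f4') (x, y) = 2 * x\<^sup>2 + 2 * y\<^sup>2"
  by (simp add: jacobian_def f4'_def pd_x_def pd_y_def varX_def varY_def power2_eq_square
      map_poly_pCons pderiv_pCons pderiv_minus eval2_def)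

lemma critical_set_f4: "critical_set f4 = {(x, y). 4 * x * y = 0}"
  by (auto simp: critical_set_def eval2_jacobian_f4)

lemma critical_set_f4': "critical_set f4' = {(x, y). 2 * x\<^sup>2 + 2 * y\<^sup>2 = 0}"
  by (auto simp: critical_set_def eval2_jacobian_f4')

lemma discriminant_set_f4:
  "(x, y) \<in> discriminant_set f4 \<longleftrightarrow> (\<exists>a b. x = a\<^sup>2 \<and> y = b\<^sup>2 \<and> a * b = 0)"
  by (auto simp: discriminant_set_def critical_set_f4 map_f4 image_def)

lemma discriminant_set_f4_real:
  "discriminant_set (f4 :: real polymap) = {(x, y). x * y = 0 \<and> x \<ge> 0 \<and> y \<ge> 0}"
proof -
  have "(\<exists>a b. x = a\<^sup>2 \<and> y = b\<^sup>2 \<and> a * b = 0) \<longleftrightarrow> x * y = 0 \<and> x \<ge> 0 \<and> y \<ge> 0" (is "?l \<longleftrightarrow> ?r")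
    for x y :: real
  proof
    assume ?r
    thus ?l by (intro exI[of _ "sqrt x"] exI[of _ "sqrt y"]) auto
  qed auto
  thus ?thesis by (simp add: set_eq_iff discriminant_set_f4)
qed

lemma discriminant_set_f4_complex:
  "discriminant_set (f4 :: complex polymap) = {(x, y). x * y = 0}"
proof -
  have "(\<exists>a b. x = a\<^sup>2 \<and> y = b\<^sup>2 \<and> a * b = 0) \<longleftrightarrow> x * y = 0" (is "?l \<longleftrightarrow> ?r")
    for x y :: complex
  proof
    assume ?r
    thus ?l by (intro exI[of _ "csqrt x"] exI[of _ "csqrt y"]) auto
  qed auto
  thus ?thesis by (simp add: set_eq_iff discriminant_set_f4)
qed

lemma poly_zero_if_nonneg:
  fixes p :: "real poly"
  assumes "\<And>x. x \<ge> 0 \<Longrightarrow> poly p x = 0"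
  shows "p = 0"
proof (rule ccontr)
  assume "p \<noteq> 0"
  hence "finite {x. poly p x = 0}" by (rule poly_roots_finite)
  moreover have "{0::real..} \<subseteq> {x. poly p x = 0}" using assms by auto
  ultimately show False using infinite_Ici finite_subset by blast
qed

text \<open>
  Evaluation in the other order, to treat \<open>eval2 p (x, y)\<close> as a polynomial in \<open>y\<close> for fixed \<open>x\<close>.
\<close>

lemma eval2_swap: "eval2 p (x, y) = poly (map_poly (\<lambda>c. poly c x) p) y"
  by (induction p) (auto simp: eval2_def map_poly_pCons)

text \<open>
  A polynomial vanishing on a half-axis vanishes on the whole axis, having infinitely many zeros
  there; and \<open>xy\<close> itself vanishes on both half-axes.
\<close>

lemma zariski_closure_discriminant_set_f4:
  "zariski_closure (discriminant_set (f4 :: real polymap)) = {(x, y). x * y = 0}" (is "?Z = ?S")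
proof
  show "?Z \<subseteq> ?S"
  proof
    fix v assume v: "v \<in> ?Z"
    have e: "eval2 (varX * varY) (x, y) = x * y" for x y :: real
      by (simp add: eval2_def varX_def varY_def mult.commute)
    have "eval2 (varX * varY) v = 0"
      using v unfolding zariski_closure_def discriminant_set_f4_real by (force simp: e)
    thus "v \<in> ?S" by (cases v) (simp add: e)
  qed
  show "?S \<subseteq> ?Z"
  proof (clarsimp simp: zariski_closure_def discriminant_set_f4_real)
    fix x y :: real and p :: "real poly poly"
    assume xy: "x = 0 \<or> y = 0"
      and z: "\<forall>a b. (a = 0 \<or> b = 0) \<and> 0 \<le> a \<and> 0 \<le> b \<longrightarrow> eval2 p (a, b) = 0"
    have "poly p [:0:] = 0"
      by (rule poly_zero_if_nonneg) (use z[rule_format, of _ 0] in \<open>simp add: eval2_def\<close>)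
    moreover have "map_poly (\<lambda>c. poly c 0) p = 0"
      by (rule poly_zero_if_nonneg) (use z in \<open>auto simp flip: eval2_swap\<close>)
    ultimately have "eval2 p (x, 0) = 0" "eval2 p (0, y) = 0"
      by (simp add: eval2_def, simp add: eval2_swap)
    thus "eval2 p (x, y) = 0" using xy by auto
  qed
qed

lemma two_intersecting_lines_axes: "two_intersecting_lines {(x, y). x * y = 0}"
proof -
  have l: "{(x, y). y = 0} = span {(1, 0) :: real \<times> real}"
    by (auto simp: span_singleton image_def)
  have m: "{(x, y). x = 0} = span {(0, 1) :: real \<times> real}"
    by (auto simp: span_singleton image_def)
  have d: "affine (span {v}) \<and> aff_dim (span {v}) = 1" if "v \<noteq> 0" for v :: "real \<times> real"
    using that by (simp add: subspace_imp_affine aff_dim_subspace dim_singleton)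
  show ?thesis unfolding two_intersecting_lines_def
  proof (intro exI conjI)
    show "{(x, y). x * y = 0} = {(x, y). y = 0} \<union> {(x, y). x = (0::real)}" by auto
    show "{(x, y). y = 0} \<noteq> {(x, y). x = (0::real)}"
      by (auto simp: set_eq_iff intro: exI[of _ 1])
    show "{(x, y). y = (0::real)} \<inter> {(x, y). x = (0::real)} \<noteq> {}" by auto
  qed (unfold l m, use d in \<open>auto simp: zero_prod_def\<close>)
qed

theorem mainTheorem12:
  shows "real_restriction_of_orbit_f4 = orbit22 (f4 :: real polymap) \<union> orbit22 (f4' :: real polymap)
    \<and> orbit22 (f4 :: real polymap) \<inter> orbit22 (f4' :: real polymap) = {}
    \<and> orbit22 (f4 :: real polymap) = {f \<in> real_restriction_of_orbit_f4. Phi1 f < 0}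
    \<and> orbit22 (f4' :: real polymap) = {f \<in> real_restriction_of_orbit_f4. Phi1 f > 0}
    \<and> (f4 :: real polymap) \<in> orbit22 f4
    \<and> (f4' :: real polymap) \<in> orbit22 f4'
    \<and> critical_set (f4 :: real polymap) = {(x, y). 4 * x * y = 0}
    \<and> two_intersecting_lines (critical_set f4)
    \<and> discriminant_set (f4 :: real polymap) = {(x, y). x * y = 0 \<and> x \<ge> 0 \<and> y \<ge> 0}
    \<and> zariski_closure (discriminant_set (f4 :: real polymap)) = {(x, y). x * y = 0}
    \<and> two_intersecting_lines (zariski_closure (discriminant_set f4))
    \<and> discriminant_set (f4 :: complex polymap) = {(x, y). x * y = 0}
    \<and> critical_set (f4' :: real polymap) = {(x, y). 2 * x\<^sup>2 + 2 * y\<^sup>2 = 0}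
    \<and> critical_set (f4' :: real polymap) = {(0, 0)}"
proof (intro conjI)
  show "critical_set (f4' :: real polymap) = {(0, 0)}"
  proof -
    have "2 * x\<^sup>2 + 2 * y\<^sup>2 = 0 \<longleftrightarrow> x = 0 \<and> y = 0" for x y :: real
      using sum_power2_eq_zero_iff[of x y] by linarith
    thus ?thesis by (auto simp: critical_set_f4')
  qed
  show "two_intersecting_lines (critical_set f4)"
    using two_intersecting_lines_axes by (simp add: critical_set_f4)
  show "two_intersecting_lines (zariski_closure (discriminant_set f4))"
    unfolding zariski_closure_discriminant_set_f4 by (rule two_intersecting_lines_axes)
qed (rule orbit22_refl critical_set_f4 critical_set_f4' discriminant_set_f4_real
      discriminant_set_f4_complex zariski_closure_discriminant_set_f4 |
     force simp: set_eq_iff real_restriction_iff orbit22_f4_real_iff orbit22_f4'_iff)+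

end
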